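(* Let $\epsilon\ge 0$ and $\beta$ be reals, and let $A,B\subseteq\{0,1\}^n$ form a Uniquely Decodable Code Pair with $|A|\ge 2^{(1-\epsilon)n}$ and $|B|\ge 2^{\beta n}$. Then $\beta\le 0.4777+\epsilon+0.7676\sqrt{\epsilon(1-\beta)}$.
   Context: Two sets $A,B\subseteq\{0,1\}^n$ form a Uniquely Decodable Code Pair (UDCP) if every pair $(a,b)\in A\times B$ yields a distinct sum $a+b$, where addition is over $\mathbb{Z}^n$; equivalently $|A+B|=|A|\cdot|B|$. *)

theory Defs
  imports "HOL-Analysis.Analysis"
begin

definition cube :: "nat \<Rightarrow> int list set" where
  "cube n = {x. length x = n \<and> set x \<subseteq> {0, 1}}"

definition vadd :: "int list \<Rightarrow> int list \<Rightarrow> int list" where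
  "vadd a b = map2 (+) a b"

definition UDCP :: "nat \<Rightarrow> int list set \<Rightarrow> int list set \<Rightarrow> bool" where
  "UDCP n A B \<longleftrightarrow> A \<subseteq> cube n \<and> B \<subseteq> cube n \<and>
     (\<forall>a\<in>A. \<forall>b\<in>B. \<forall>a'\<in>A. \<forall>b'\<in>B. vadd a b = vadd a' b' \<longrightarrow> a = a' \<and> b = b')"

end

theory Submission
  imports Defs
begin

text \<open>
  Let \<open>p = (1 - \<rho>) / 2\<close> and let \<open>P\<close> be the sum over \<open>(a, b) \<in> A \<times> B\<close> of
  \<open>p\<^sup>d (1 - p)\<^bsup>n-d\<^esup>\<close>, where \<open>d\<close> is the Hamming distance of \<open>a\<close> and \<open>b\<close>. The summand depends
  only on \<open>a - b\<close>, and differences are unique as well, since \<open>a - b = a' - b'\<close> means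
  \<open>a + b' = a' + b\<close>. Hence \<open>P\<close> is at most the full sum over \<open>{-1, 0, 1}\<^sup>n\<close>, which is \<open>(1 + p)\<^sup>n\<close>.
  Reverse hypercontractivity gives \<open>P \<ge> 2\<^sup>n \<mu>(A)\<^sup>\<alpha> \<mu>(B)\<^sup>\<gamma>\<close>, where \<open>\<mu>\<close> is the uniform measure on
  the cube, whenever \<open>(1 - 1/\<alpha>)(1 - 1/\<gamma>) = \<rho>\<^sup>2\<close>. Optimising over \<open>\<alpha>\<close> and \<open>\<gamma>\<close> and taking
  \<open>\<rho> = 0.3838\<close>, which nearly maximises \<open>(1 - \<rho>\<^sup>2) (1 - log 2 (1 + p))\<close>, gives the constants.
\<close>

section \<open>The two-point inequality\<close>

text \<open>The mean value theorem turns the left side into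
  \<open>m * s * ((1 + z) powr (m - 1) + (1 - z) powr (m - 1))\<close> with
  \<open>0 < z < s\<close>. AM-GM bounds the bracket below by twice the power of
  \<open>1 - z\<^sup>2\<close>, which dominates that of \<open>1 - s\<^sup>2\<close> because
  \<open>m \<ge> 1\<close>.\<close>

lemma powr_diff_ge:
  fixes m s :: real
  assumes "m \<ge> 1" "0 \<le> s" "s < 1"
  shows "(1 + s) powr m - (1 - s) powr m \<ge> 2 * m * s * (1 - s\<^sup>2) powr ((m - 1) / 2)"
proof (cases "s = 0")
  case False
  let ?f = "\<lambda>u::real. (1 + u) powr m - (1 - u) powr m"
  let ?f' = "\<lambda>u::real. m * (1 + u) powr (m - 1) + m * (1 - u) powr (m - 1)"
  have "\<exists>z>0. z < s \<and> ?f s - ?f 0 = (s - 0) * ?f' z"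
    using assms False
    by (intro MVT2) (auto intro!: derivative_eq_intros simp: powr_diff field_simps)
  then obtain z where z: "0 < z" "z < s" "?f s = s * ?f' z"
    by auto
  have "2 * (1 - s\<^sup>2) powr ((m - 1) / 2) \<le> 2 * (1 - z\<^sup>2) powr ((m - 1) / 2)"
    using assms z by (simp add: powr_mono2 power_mono abs_square_le_1)
  also have "1 - z\<^sup>2 = (1 + z) * (1 - z)"
    by (simp add: power2_eq_square algebra_simps)
  also have "2 * ((1 + z) * (1 - z)) powr ((m - 1) / 2)
      = 2 * (1 + z) powr ((m - 1) / 2) * (1 - z) powr ((m - 1) / 2)"
    using assms z by (simp add: powr_mult)
  also have "\<dots> \<le> ((1 + z) powr ((m - 1) / 2))\<^sup>2 + ((1 - z) powr ((m - 1) / 2))\<^sup>2"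
    by (rule sum_squares_bound)
  also have "\<dots> = (1 + z) powr (m - 1) + (1 - z) powr (m - 1)"
    by (simp add: power2_eq_square powr_add [symmetric])
  finally have "m * s * (2 * (1 - s\<^sup>2) powr ((m - 1) / 2))
      \<le> m * s * ((1 + z) powr (m - 1) + (1 - z) powr (m - 1))"
    using assms by (intro mult_left_mono) auto
  then show ?thesis
    using z(3) by (simp add: algebra_simps)
qed simp

text \<open>Both sides vanish at \<open>s = 0\<close>. The derivative of their difference is
  \<open>\<alpha> / 2\<close> times the gap in \<open>powr_diff_ge\<close> for
  \<open>m = 2 * \<alpha> - 1\<close>, hence nonnegative.\<close>

lemma powr_diff_square_ge:
  fixes \<alpha> s :: real
  assumes "\<alpha> \<ge> 1" "0 \<le> s" "s \<le> 1"
  shows "(((1 + s) powr \<alpha> - (1 - s) powr \<alpha>) / 2)\<^sup>2 \<ge> \<alpha> * (1 - (1 - s\<^sup>2) powr \<alpha>)"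
proof -
  define h where "h = (\<lambda>s::real. (((1 + s) powr \<alpha> - (1 - s) powr \<alpha>) / 2)\<^sup>2
      - \<alpha> * (1 - (1 - s\<^sup>2) powr \<alpha>))"
  have "h 0 \<le> h s"
  \<comment> \<open>Derivatives are taken only in the open interval; the endpoint
    \<open>s = 1\<close>, which later encodes \<open>v = 0\<close>, is reached by
    continuity.\<close>
  proof (rule DERIV_nonneg_imp_increasing_open [of 0 s h])
    fix x assume x: "0 < x" "x < s"
    define P where "P = (1 + x) powr (\<alpha> - 1)"
    define Q where "Q = (1 - x) powr (\<alpha> - 1)"
    have P: "(1 + x) powr \<alpha> = (1 + x) * P" and Q: "(1 - x) powr \<alpha> = (1 - x) * Q"
      using x assms by (auto simp: P_def Q_def powr_diff)
    have x2: "x\<^sup>2 < 1"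
      using x assms by (simp add: abs_square_less_1)
    have R: "(1 - x\<^sup>2) powr (\<alpha> - 1) = P * Q"
      using x assms
      by (simp add: P_def Q_def powr_mult [symmetric] power2_eq_square algebra_simps)
    define D where "D = ((1 + x) * P - (1 - x) * Q) / 2 * (\<alpha> * (P + Q))
        - \<alpha> * (\<alpha> * (P * Q) * (2 * x))"
    have "((\<lambda>s. (1 + s) powr \<alpha>) has_real_derivative \<alpha> * P) (at x)"
         "((\<lambda>s. (1 - s) powr \<alpha>) has_real_derivative - (\<alpha> * Q)) (at x)"
         "((\<lambda>s. (1 - s\<^sup>2) powr \<alpha>) has_real_derivative - (\<alpha> * (P * Q) * (2 * x))) (at x)"
      unfolding R [symmetric] unfolding P_def Q_def
      using x x2 assms by (auto intro!: derivative_eq_intros simp: powr_diff field_simps)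
    note der = this
    have "(h has_real_derivative D) (at x)"
      unfolding h_def D_def
      by (rule derivative_eq_intros der refl | simp add: P Q field_simps)+
    moreover have "D \<ge> 0"
    proof -
      have e: "2 * \<alpha> - 1 = 1 + (\<alpha> - 1) + (\<alpha> - 1)"
        by simp
      have "(1 + x) powr (2 * \<alpha> - 1) - (1 - x) powr (2 * \<alpha> - 1)
          \<ge> 2 * (2 * \<alpha> - 1) * x * (P * Q)"
        using powr_diff_ge [of "2 * \<alpha> - 1" x] x assms
        by (simp add: R [symmetric] diff_divide_distrib)
      moreover have "(1 + x) powr (2 * \<alpha> - 1) = (1 + x) * P * P"
        unfolding e powr_add P_def using x by simp
      moreover have "(1 - x) powr (2 * \<alpha> - 1) = (1 - x) * Q * Q"
        unfolding e powr_add Q_def using x assms by simp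
      ultimately have "(1 + x) * P * P - (1 - x) * Q * Q - 2 * (2 * \<alpha> - 1) * x * (P * Q) \<ge> 0"
        by simp
      then have "\<alpha> / 2 * ((1 + x) * P * P - (1 - x) * Q * Q - 2 * (2 * \<alpha> - 1) * x * (P * Q)) \<ge> 0"
        using assms by simp
      then show ?thesis
        by (simp add: D_def field_simps)
    qed
    ultimately show "\<exists>y. (h has_real_derivative y) (at x) \<and> 0 \<le> y"
      by blast
  next
    have cont: "continuous_on {0..s} (\<lambda>x. f x powr \<alpha>)"
      if "continuous_on {0..s} f" "\<And>x. x \<in> {0..s} \<Longrightarrow> f x \<ge> 0" for f
      using that assms by (intro continuous_on_powr') auto
    show "continuous_on {0..s} h"
      unfolding h_def using assms
      by (intro continuous_on_diff continuous_on_divide continuous_on_power continuous_on_mult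
          continuous_on_add continuous_on_const continuous_on_id cont)
        (auto simp: abs_square_le_1)
  qed (use assms in auto)
  then show ?thesis
    by (simp add: h_def)
qed

text \<open>By symmetry and homogeneity one may write \<open>u = m * (1 + s)\<close> and
  \<open>v = m * (1 - s)\<close>. Since
  \<open>((P + Q) / 2)\<^sup>2 - ((P - Q) / 2)\<^sup>2 = P * Q\<close>, the claim becomes
  \<open>powr_diff_square_ge\<close> divided by \<alpha>.\<close>

lemma powr_mean_square_gap:
  fixes \<alpha> u v :: real
  assumes "\<alpha> \<ge> 1" "u \<ge> 0" "v \<ge> 0"
  shows "((u powr \<alpha> + v powr \<alpha>) / 2)\<^sup>2 - (((u + v) / 2) powr \<alpha>)\<^sup>2
    \<ge> (1 - 1 / \<alpha>) * ((u powr \<alpha> - v powr \<alpha>) / 2)\<^sup>2"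
  using assms(2,3)
proof (induction u v rule: linorder_wlog)
  case (sym u v)
  have "((u powr \<alpha> - v powr \<alpha>) / 2)\<^sup>2 = ((v powr \<alpha> - u powr \<alpha>) / 2)\<^sup>2"
    by (simp add: power_divide power2_commute)
  with sym show ?case
    by (simp add: add.commute)
next
  case (le v u)
  show ?case
  proof (cases "u = 0")
    case True
    with le show ?thesis by simp
  next
    case False
    define m where "m = (u + v) / 2"
    define s where "s = (u - v) / (u + v)"
    have m: "m > 0" and s: "0 \<le> s" "s \<le> 1"
      using le False by (auto simp: m_def s_def)
    have uv: "u = m * (1 + s)" "v = m * (1 - s)"
      using le False by (auto simp: m_def s_def field_simps)
    define M where "M = m powr \<alpha>"
    define P where "P = (1 + s) powr \<alpha>"
    define Q where "Q = (1 - s) powr \<alpha>"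
    have pu: "u powr \<alpha> = M * P" and pv: "v powr \<alpha> = M * Q"
      using m s by (auto simp: uv M_def P_def Q_def powr_mult)
    have "P * Q = (1 - s\<^sup>2) powr \<alpha>"
      using s by (simp add: P_def Q_def powr_mult [symmetric] power2_eq_square algebra_simps)
    with powr_diff_square_ge [OF assms(1) s]
    have "\<alpha> * (1 - P * Q) \<le> ((P - Q) / 2)\<^sup>2"
      by (simp add: P_def Q_def)
    then have "P * Q + ((P - Q) / 2)\<^sup>2 / \<alpha> - 1 \<ge> 0"
      using assms(1) by (simp add: field_simps)
    then have "M\<^sup>2 * (P * Q + ((P - Q) / 2)\<^sup>2 / \<alpha> - 1) \<ge> 0"
      by simp
    also have "M\<^sup>2 * (P * Q + ((P - Q) / 2)\<^sup>2 / \<alpha> - 1) =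
      ((M * P + M * Q) / 2)\<^sup>2 - M\<^sup>2 - (1 - 1 / \<alpha>) * ((M * Q - M * P) / 2)\<^sup>2"
      using assms(1) by (simp add: field_simps power2_eq_square)
    finally show ?thesis
      by (simp add: pu pv M_def m_def add.commute)
  qed
qed

text \<open>
  In terms of the even and odd parts \<open>X, S\<close> and \<open>Y, T\<close> the claim reads
  \<open>M N \<le> X Y + \<rho> S T\<close>. It follows from \<open>(X Y - M N)\<^sup>2 \<ge> (X\<^sup>2 - M\<^sup>2) (Y\<^sup>2 - N\<^sup>2)\<close>, which
  decouples the two functions.
\<close>

lemma reverse_hypercontractive_two_point:
  fixes \<alpha> \<gamma> \<rho> u0 u1 v0 v1 :: real
  assumes "\<alpha> \<ge> 1" "\<gamma> \<ge> 1" "\<rho>\<^sup>2 \<le> (1 - 1 / \<alpha>) * (1 - 1 / \<gamma>)"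
    and "u0 \<ge> 0" "u1 \<ge> 0" "v0 \<ge> 0" "v1 \<ge> 0"
  shows "((u0 + u1) / 2) powr \<alpha> * ((v0 + v1) / 2) powr \<gamma>
    \<le> (1 + \<rho>) / 4 * (u0 powr \<alpha> * v0 powr \<gamma> + u1 powr \<alpha> * v1 powr \<gamma>)
      + (1 - \<rho>) / 4 * (u0 powr \<alpha> * v1 powr \<gamma> + u1 powr \<alpha> * v0 powr \<gamma>)"
proof -
  define X where "X = (u0 powr \<alpha> + u1 powr \<alpha>) / 2"
  define S where "S = (u0 powr \<alpha> - u1 powr \<alpha>) / 2"
  define M where "M = ((u0 + u1) / 2) powr \<alpha>"
  define Y where "Y = (v0 powr \<gamma> + v1 powr \<gamma>) / 2"
  define T where "T = (v0 powr \<gamma> - v1 powr \<gamma>) / 2"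
  define N where "N = ((v0 + v1) / 2) powr \<gamma>"
  define c where "c = 1 - 1 / \<alpha>"
  define d where "d = 1 - 1 / \<gamma>"
  have cd: "c \<ge> 0" "d \<ge> 0"
    using assms by (auto simp: c_def d_def)
  have nonneg: "X \<ge> 0" "M \<ge> 0" "Y \<ge> 0" "N \<ge> 0"
    by (auto simp: X_def M_def Y_def N_def)
  have gX: "X\<^sup>2 - M\<^sup>2 \<ge> c * S\<^sup>2"
    unfolding X_def M_def S_def c_def by (rule powr_mean_square_gap) (use assms in auto)
  have gY: "Y\<^sup>2 - N\<^sup>2 \<ge> d * T\<^sup>2"
    unfolding Y_def N_def T_def d_def by (rule powr_mean_square_gap) (use assms in auto)
  have cS: "c * S\<^sup>2 \<ge> 0" and dT: "d * T\<^sup>2 \<ge> 0"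
    using cd by auto
  \<comment> \<open>The sign of \<open>X * Y - M * N\<close> is needed to pass from the inequality
    of squares below to one of absolute values.\<close>
  have "M\<^sup>2 \<le> X\<^sup>2" "N\<^sup>2 \<le> Y\<^sup>2"
    using gX gY cS dT by linarith+
  then have "M \<le> X" "N \<le> Y"
    using nonneg by (auto dest: power2_le_imp_le)
  then have le: "M * N \<le> X * Y"
    using nonneg by (intro mult_mono) auto
  have "(\<rho> * S * T)\<^sup>2 = \<rho>\<^sup>2 * (S\<^sup>2 * T\<^sup>2)"
    by (simp add: power_mult_distrib)
  also have "\<dots> \<le> (c * d) * (S\<^sup>2 * T\<^sup>2)"
    using assms(3) by (intro mult_right_mono) (auto simp: c_def d_def)
  also have "\<dots> = (c * S\<^sup>2) * (d * T\<^sup>2)"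
    by simp
  also have "\<dots> \<le> (X\<^sup>2 - M\<^sup>2) * (Y\<^sup>2 - N\<^sup>2)"
    using gX gY cS dT by (intro mult_mono) auto
  also have "\<dots> = (X * Y - M * N)\<^sup>2 - (X * N - M * Y)\<^sup>2"
    by (simp add: power2_eq_square algebra_simps)
  also have "\<dots> \<le> (X * Y - M * N)\<^sup>2"
    by simp
  finally have "\<bar>\<rho> * S * T\<bar> \<le> X * Y - M * N"
    using le by (metis abs_le_square_iff abs_of_nonneg diff_ge_0_iff_ge)
  then have "M * N \<le> X * Y + \<rho> * (S * T)"
    by (simp add: abs_le_iff algebra_simps)
  also have "\<dots> = (1 + \<rho>) / 4 * (u0 powr \<alpha> * v0 powr \<gamma> + u1 powr \<alpha> * v1 powr \<gamma>)
      + (1 - \<rho>) / 4 * (u0 powr \<alpha> * v1 powr \<gamma> + u1 powr \<alpha> * v0 powr \<gamma>)"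
    by (simp add: X_def Y_def S_def T_def field_simps)
  finally show ?thesis
    by (simp add: M_def N_def)
qed

section \<open>Tensorisation to the cube\<close>

text \<open>On the cube this is the transition probability of the binary symmetric channel with
  crossover probability \<open>p\<close>. Writing it through the difference list allows reindexing
  by differences later.\<close>

definition noise_kernel :: "real \<Rightarrow> int list \<Rightarrow> int list \<Rightarrow> real" where
  "noise_kernel p a b = (\<Prod>z\<leftarrow>map2 (-) a b. if z = 0 then 1 - p else p)"

lemma noise_kernel_Cons [simp]:
  "noise_kernel p (x # a) (y # b) = (if x = y then 1 - p else p) * noise_kernel p a b"
  by (simp add: noise_kernel_def)

definition tails :: "'a \<Rightarrow> 'a list set \<Rightarrow> 'a list set" where
  "tails c A = {xs. c # xs \<in> A}"

lemma finite_cube [simp]: "finite (cube n)"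
  using finite_lists_length_eq [of "{0, 1 :: int}" n]
  by (simp add: cube_def conj_commute)

lemma tails_subset_cube: "A \<subseteq> cube (Suc n) \<Longrightarrow> tails c A \<subseteq> cube n"
  by (force simp: tails_def cube_def)

lemma sum_cube_Suc:
  assumes "A \<subseteq> cube (Suc n)"
  shows "sum f A = (\<Sum>xs\<in>tails 0 A. f (0 # xs)) + (\<Sum>xs\<in>tails 1 A. f (1 # xs))"
proof -
  define X where "X = (\<lambda>c. (#) c ` tails c A)"
  have A: "A = X 0 \<union> X 1"
  proof (intro equalityI subsetI)
    fix x assume "x \<in> A"
    then have "x \<in> cube (Suc n)"
      using assms by blast
    then obtain c xs where "x = c # xs" "c = 0 \<or> c = 1"
      by (cases x) (auto simp: cube_def)
    with \<open>x \<in> A\<close> show "x \<in> X 0 \<union> X 1"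
      by (auto simp: X_def tails_def)
  qed (auto simp: X_def tails_def)
  have fin: "finite (X c)" for c
    unfolding X_def
    by (rule finite_imageI, rule finite_subset [OF tails_subset_cube [OF assms] finite_cube])
  have "sum f A = sum f (X 0) + sum f (X 1)"
    unfolding A by (rule sum.union_disjoint [OF fin fin]) (auto simp: X_def)
  then show ?thesis
    by (simp add: X_def sum.reindex)
qed

lemma card_cube_Suc:
  assumes "A \<subseteq> cube (Suc n)"
  shows "card A = card (tails 0 A) + card (tails 1 A)"
  using sum_cube_Suc [OF assms, of "\<lambda>_. 1::nat"] by simp

text \<open>Conditioning on the first coordinates splits the kernel sum into four sums in dimension
  \<open>n\<close>. Induction bounds each by powers of the densities of the slices, and the
  two-point inequality applied to these densities recombines them.\<close>

lemma reverse_hypercontractive_cube: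
  fixes \<alpha> \<gamma> \<rho> :: real
  assumes "\<alpha> \<ge> 1" "\<gamma> \<ge> 1" "\<rho>\<^sup>2 \<le> (1 - 1 / \<alpha>) * (1 - 1 / \<gamma>)" "\<bar>\<rho>\<bar> \<le> 1"
    and "A \<subseteq> cube n" "B \<subseteq> cube n"
  shows "2 ^ n * ((card A / 2 ^ n) powr \<alpha> * (card B / 2 ^ n) powr \<gamma>)
    \<le> (\<Sum>a\<in>A. \<Sum>b\<in>B. noise_kernel ((1 - \<rho>) / 2) a b)"
  using assms(5,6)
proof (induction n arbitrary: A B)
  case 0
  then have "A = {} \<or> A = {[]}" "B = {} \<or> B = {[]}"
    by (auto simp: cube_def)
  then show ?case
    by (auto simp: noise_kernel_def)
next
  case (Suc n)
  define p where "p = (1 - \<rho>) / 2"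
  define S where "S = (\<lambda>A B. \<Sum>a\<in>A. \<Sum>b\<in>B. noise_kernel p a b)"
  define u where "u = (\<lambda>c. card (tails c A) / 2 ^ n)"
  define v where "v = (\<lambda>c. card (tails c B) / 2 ^ n)"
  have IH: "2 ^ n * (u c powr \<alpha> * v d powr \<gamma>) \<le> S (tails c A) (tails d B)" for c d
    unfolding u_def v_def S_def p_def by (rule Suc.IH; rule tails_subset_cube; rule Suc.prems)
  have cards: "card A / 2 ^ Suc n = (u 0 + u 1) / 2" "card B / 2 ^ Suc n = (v 0 + v 1) / 2"
    by (auto simp: card_cube_Suc [OF Suc.prems(1)] card_cube_Suc [OF Suc.prems(2)]
        u_def v_def field_simps)
  have p: "1 - p = (1 + \<rho>) / 2" "p \<ge> 0" "1 - p \<ge> 0"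
    using assms(4) by (auto simp: p_def field_simps)
  have "2 ^ Suc n * ((card A / 2 ^ Suc n) powr \<alpha> * (card B / 2 ^ Suc n) powr \<gamma>)
      \<le> 2 ^ Suc n * ((1 + \<rho>) / 4 * (u 0 powr \<alpha> * v 0 powr \<gamma> + u 1 powr \<alpha> * v 1 powr \<gamma>)
        + (1 - \<rho>) / 4 * (u 0 powr \<alpha> * v 1 powr \<gamma> + u 1 powr \<alpha> * v 0 powr \<gamma>))"
    unfolding cards
    by (intro mult_left_mono reverse_hypercontractive_two_point assms(1-3)) (auto simp: u_def v_def)
  also have "\<dots> = (1 - p) * (2 ^ n * (u 0 powr \<alpha> * v 0 powr \<gamma>))
      + (1 - p) * (2 ^ n * (u 1 powr \<alpha> * v 1 powr \<gamma>))
      + p * (2 ^ n * (u 0 powr \<alpha> * v 1 powr \<gamma>)) + p * (2 ^ n * (u 1 powr \<alpha> * v 0 powr \<gamma>))"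
    by (simp add: p_def field_simps)
  also have "\<dots> \<le> (1 - p) * S (tails 0 A) (tails 0 B) + (1 - p) * S (tails 1 A) (tails 1 B)
      + p * S (tails 0 A) (tails 1 B) + p * S (tails 1 A) (tails 0 B)"
    using p by (intro add_mono mult_left_mono IH) auto
  also have "\<dots> = S A B"
    by (simp add: S_def sum_cube_Suc [OF Suc.prems(1)] sum_cube_Suc [OF Suc.prems(2)]
        sum.distrib sum_distrib_left algebra_simps)
  finally show ?case
    by (simp add: S_def p_def)
qed

section \<open>Upper bound from unique decodability\<close>

lemma sum_prod_list_lists_length:
  fixes f :: "'a \<Rightarrow> 'b::comm_semiring_1"
  shows "(\<Sum>xs | set xs \<subseteq> S \<and> length xs = n. \<Prod>x\<leftarrow>xs. f x) = (\<Sum>x\<in>S. f x) ^ n"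
proof (induction n)
  case 0
  have "{xs. set xs \<subseteq> S \<and> length xs = 0} = {[]}"
    by auto
  then show ?case
    by simp
next
  case (Suc n)
  have "inj_on (\<lambda>(xs, x). x # xs) ({xs. set xs \<subseteq> S \<and> length xs = n} \<times> S)"
    by (auto simp: inj_on_def)
  then have "(\<Sum>xs | set xs \<subseteq> S \<and> length xs = Suc n. \<Prod>x\<leftarrow>xs. f x)
      = (\<Sum>(xs, x)\<in>{xs. set xs \<subseteq> S \<and> length xs = n} \<times> S. f x * (\<Prod>x\<leftarrow>xs. f x))"
    by (simp add: lists_length_Suc_eq sum.reindex case_prod_unfold)
  also have "\<dots> = (\<Sum>x\<in>S. f x) * (\<Sum>xs | set xs \<subseteq> S \<and> length xs = n. \<Prod>x\<leftarrow>xs. f x)"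
    by (simp add: sum.cartesian_product [symmetric] sum_product sum.swap [of _ S])
  finally show ?case
    by (simp add: Suc.IH)
qed

lemma UDCP_inj_on_diff:
  assumes "UDCP n A B"
  shows "inj_on (\<lambda>(a, b). map2 (-) a b) (A \<times> B)"
proof (clarsimp simp: inj_on_def)
  fix a b a' b'
  assume mem: "a \<in> A" "b \<in> B" "a' \<in> A" "b' \<in> B" and eq: "map2 (-) a b = map2 (-) a' b'"
  have len: "length a = n" "length b = n" "length a' = n" "length b' = n"
    using assms mem by (auto simp: UDCP_def cube_def)
  have "vadd a b' = vadd a' b"
  proof (rule nth_equalityI)
    fix i assume "i < length (vadd a b')"
    then have "i < n"
      using len by (simp add: vadd_def)
    with arg_cong [OF eq, of "\<lambda>z. z ! i"] len show "vadd a b' ! i = vadd a' b ! i"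
      by (simp add: vadd_def)
  qed (simp add: vadd_def len)
  with assms mem show "a = a' \<and> b = b'"
    unfolding UDCP_def by metis
qed

text \<open>Distinct pairs give distinct differences, and the weights are nonnegative, so extending
  the sum to all of \<open>{-1, 0, 1}\<close> lists only increases it. Each coordinate then
  contributes \<open>(1 - p) + p + p\<close>.\<close>

lemma UDCP_sum_noise_kernel_le:
  assumes "UDCP n A B" "0 \<le> p" "p \<le> 1"
  shows "(\<Sum>a\<in>A. \<Sum>b\<in>B. noise_kernel p a b) \<le> (1 + p) ^ n"
proof -
  define w where "w = (\<lambda>z::int. if z = 0 then 1 - p else p)"
  have sub: "(\<lambda>(a, b). map2 (-) a b) ` (A \<times> B) \<subseteq> {z. set z \<subseteq> {-1, 0, 1} \<and> length z = n}"
  proof clarsimp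
    fix a b assume "a \<in> A" "b \<in> B"
    then have len: "length a = n" "length b = n" and "set a \<subseteq> {0, 1}" "set b \<subseteq> {0, 1}"
      using assms by (auto simp: UDCP_def cube_def)
    have D: "(\<lambda>(x, y). x - y) z \<in> {-1, 0, 1}" if "z \<in> set (zip a b)" for z
    proof -
      obtain x y where z: "z = (x, y)"
        by fastforce
      then have "x \<in> set a" "y \<in> set b"
        using that by (auto dest: set_zip_leftD set_zip_rightD)
      then have "x \<in> {0, 1}" "y \<in> {0, 1}"
        using \<open>set a \<subseteq> {0, 1}\<close> \<open>set b \<subseteq> {0, 1}\<close> by blast+
      then show ?thesis
        by (auto simp: z)
    qed
    show "(\<lambda>(x, y). x - y) ` set (zip a b) \<subseteq> {-1, 0, 1} \<and> min (length a) (length b) = n"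
      by (intro conjI image_subsetI D) (simp_all add: len)
  qed
  have "(\<Sum>a\<in>A. \<Sum>b\<in>B. noise_kernel p a b)
      = (\<Sum>z\<in>(\<lambda>(a, b). map2 (-) a b) ` (A \<times> B). \<Prod>x\<leftarrow>z. w x)"
    unfolding sum.reindex [OF UDCP_inj_on_diff [OF assms(1)]] sum.cartesian_product
    by (simp add: noise_kernel_def w_def case_prod_unfold)
  also have "\<dots> \<le> (\<Sum>z | set z \<subseteq> {-1, 0, 1} \<and> length z = n. \<Prod>x\<leftarrow>z. w x)"
    using assms(2,3) sub
    by (intro sum_mono2 prod_list_nonneg finite_lists_length_eq) (auto simp: w_def)
  also have "\<dots> = (1 + p) ^ n"
    by (simp add: sum_prod_list_lists_length w_def add.commute)
  finally show ?thesis .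
qed

section \<open>Optimisation of the exponents and numerical constants\<close>

text \<open>Comparing the two bounds on the kernel sum on the scale of base 2 exponents per
  coordinate gives \<open>1 - \<epsilon> * \<alpha> - (1 - \<beta>) * \<gamma> \<le> log 2
  q\<close>; inserting the optimal exponents and multiplying by \<open>1 - \<rho>\<^sup>2\<close>
  yields the claim.\<close>

lemma UDCP_exponent_ge:
  fixes \<epsilon> \<beta> \<rho> :: real
  assumes "n \<ge> 1" "UDCP n A B" "0 < \<epsilon>" "\<beta> < 1" "0 \<le> \<rho>" "\<rho> < 1"
    and A: "real (card A) \<ge> 2 powr ((1 - \<epsilon>) * real n)"
    and B: "real (card B) \<ge> 2 powr (\<beta> * real n)"
  shows "(1 - \<rho>\<^sup>2) * (1 - log 2 (1 + (1 - \<rho>) / 2))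
    \<le> \<epsilon> + (1 - \<beta>) + 2 * \<rho> * sqrt (\<epsilon> * (1 - \<beta>))"
proof -
  define s where "s = sqrt \<epsilon>"
  define t where "t = sqrt (1 - \<beta>)"
  have st: "s > 0" "t > 0" "s\<^sup>2 = \<epsilon>" "t\<^sup>2 = 1 - \<beta>" "sqrt (\<epsilon> * (1 - \<beta>)) = s * t"
    using assms by (auto simp: s_def t_def real_sqrt_mult)
  define r where "r = 1 - \<rho>\<^sup>2"
  have r: "0 < r" "r \<le> 1"
    using assms by (auto simp: r_def abs_square_less_1)
  \<comment> \<open>These minimise \<open>\<epsilon> \<alpha> + (1 - \<beta>) \<gamma>\<close> subject to \<open>(1 - 1/\<alpha>)(1 - 1/\<gamma>) = \<rho>\<^sup>2\<close>.\<close>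
  define \<alpha> where "\<alpha> = (1 + \<rho> * t / s) / r"
  define \<gamma> where "\<gamma> = (1 + \<rho> * s / t) / r"
  have \<alpha>: "\<alpha> \<ge> 1" and \<gamma>: "\<gamma> \<ge> 1"
    using r st assms by (auto simp: \<alpha>_def \<gamma>_def le_divide_eq intro: order_trans)
  have pos: "s + \<rho> * t > 0" "t + \<rho> * s > 0"
    using st assms by (auto intro: add_pos_nonneg)
  \<comment> \<open>The two factors are \<rho> times mutually reciprocal fractions, so the
    constraint holds with equality.\<close>
  have "1 - 1 / \<alpha> = \<rho> * (t + \<rho> * s) / (s + \<rho> * t)"
    using st pos r by (simp add: \<alpha>_def field_simps) (simp add: r_def power2_eq_square algebra_simps)
  moreover have "1 - 1 / \<gamma> = \<rho> * (s + \<rho> * t) / (t + \<rho> * s)"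
    using st pos r by (simp add: \<gamma>_def field_simps) (simp add: r_def power2_eq_square algebra_simps)
  ultimately have "(1 - 1 / \<alpha>) * (1 - 1 / \<gamma>) = \<rho>\<^sup>2"
    using pos by (simp only: times_divide_times_eq) (simp add: power2_eq_square)
  then have cond: "\<rho>\<^sup>2 \<le> (1 - 1 / \<alpha>) * (1 - 1 / \<gamma>)"
    by simp
  define q where "q = 1 + (1 - \<rho>) / 2"
  have q: "q > 0"
    using assms(6) by (simp add: q_def field_simps)
  have sub: "A \<subseteq> cube n" "B \<subseteq> cube n"
    using assms by (auto simp: UDCP_def)
  have "2 powr (real n * (1 - \<epsilon> * \<alpha> - (1 - \<beta>) * \<gamma>))
      = 2 ^ n * ((2 powr (- \<epsilon> * n)) powr \<alpha> * (2 powr ((\<beta> - 1) * n)) powr \<gamma>)"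
    by (simp add: powr_powr powr_add [symmetric] powr_realpow [symmetric] algebra_simps)
  also have "\<dots> \<le> 2 ^ n * ((card A / 2 ^ n) powr \<alpha> * (card B / 2 ^ n) powr \<gamma>)"
  proof -
    have "2 powr (- \<epsilon> * n) \<le> card A / 2 ^ n" "2 powr ((\<beta> - 1) * n) \<le> card B / 2 ^ n"
      using A B
      by (auto simp: le_divide_eq powr_add [symmetric] powr_realpow [symmetric] algebra_simps)
    then show ?thesis
      using \<alpha> \<gamma> by (intro mult_left_mono mult_mono powr_mono2) auto
  qed
  also have "\<dots> \<le> (\<Sum>a\<in>A. \<Sum>b\<in>B. noise_kernel ((1 - \<rho>) / 2) a b)"
    using assms by (intro reverse_hypercontractive_cube \<alpha> \<gamma> cond sub) auto
  also have "\<dots> \<le> q ^ n"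
    unfolding q_def using assms by (intro UDCP_sum_noise_kernel_le) auto
  also have "\<dots> = 2 powr (log 2 q * real n)"
    using q by (simp add: powr_realpow [symmetric] powr_powr [symmetric])
  finally have "1 - \<epsilon> * \<alpha> - (1 - \<beta>) * \<gamma> \<le> log 2 q"
    using assms(1) by (simp add: mult.commute [of "log 2 q"])
  then have "r * (1 - log 2 q) \<le> r * (s\<^sup>2 * \<alpha> + t\<^sup>2 * \<gamma>)"
    using r st by (intro mult_left_mono) auto
  also have "\<dots> = s\<^sup>2 + t\<^sup>2 + 2 * \<rho> * (s * t)"
    using r st by (simp add: \<alpha>_def \<gamma>_def field_simps power2_eq_square)
  finally show ?thesis
    by (simp add: st r_def q_def)
qed

lemma log2_1_3081_le: "log 2 (1.3081 :: real) \<le> 0.3874733"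
proof -
  \<comment> \<open>For \<open>x = 1.3081\<close> this is \<open>(x - 1) / (x + 1)\<close>, the
    argument of the series \<open>ln x = 2 * artanh y\<close>; the tail is bounded geometrically.
    For \<open>ln 2\<close> the argument is \<open>1 / 3\<close>.\<close>
  define y :: real where "y = 3081 / 23081"
  have "ln (1.3081 :: real) \<le> (\<Sum>k<4. 2 * y ^ (2 * k + 1) / real (2 * k + 1))
      + 2 * (y ^ 9 / (1 - y\<^sup>2) / 9)"
    using ln_approx_bounds [of "1.3081" 4] by (simp add: y_def)
  also have "\<dots> \<le> 0.26857583"
    by (simp add: lessThan_nat_numeral lessThan_Suc y_def power_divide)
  finally have "ln (1.3081 :: real) \<le> 0.26857583" .
  moreover have "(\<Sum>k<7. 2 * (1 / 3) ^ (2 * k + 1) / real (2 * k + 1)) \<le> ln (2 :: real)"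
    using ln_approx_bounds [of 2 7] by simp
  then have "ln (2 :: real) \<ge> 0.6931470"
    by (simp add: lessThan_nat_numeral lessThan_Suc power_divide)
  ultimately show ?thesis
    by (simp add: log_def divide_le_eq)
qed

theorem theorem2:
  fixes n :: nat and \<epsilon> \<beta> :: real and A B :: "int list set"
  assumes "n \<ge> 1"
    and "\<epsilon> \<ge> 0"
    and "UDCP n A B"
    and "real (card A) \<ge> 2 powr ((1 - \<epsilon>) * real n)"
    and "real (card B) \<ge> 2 powr (\<beta> * real n)"
  shows "\<beta> \<le> 0.4777 + \<epsilon> + 0.7676 * sqrt (\<epsilon> * (1 - \<beta>))"
proof -
  \<comment> \<open>The optimal exponents blow up at \<open>\<epsilon> = 0\<close> and at \<open>\<beta> = 1\<close>, so both are perturbed by \<open>d k\<close>.\<close>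
  define d where "d = (\<lambda>k::nat. 1 / real (Suc k))"
  have d: "d \<longlonglongrightarrow> 0"
    unfolding d_def by (rule LIMSEQ_Suc [OF lim_1_over_n])
  \<comment> \<open>The trivial size bound gives \<open>\<beta> \<le> 1\<close>, so that
    \<open>\<beta> - d k < 1\<close> below.\<close>
  have "card B \<le> card (cube n)"
    using assms(3) by (intro card_mono) (auto simp: UDCP_def)
  also have "card (cube n) = 2 ^ n"
    using card_lists_length_eq [of "{0, 1 :: int}" n]
    by (simp add: cube_def conj_commute numeral_2_eq_2)
  finally have "real (card B) \<le> 2 powr (1 * real n)"
    by (simp add: powr_realpow)
  with assms(5) have "2 powr (\<beta> * real n) \<le> 2 powr (1 * real n)"
    by (rule order_trans)
  then have "\<beta> \<le> 1"
    using assms(1) by simp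
  \<comment> \<open>Lowering both exponents by \<open>d k\<close> only weakens the size hypotheses.
    Here \<open>0.5223 = 1 - 0.4777\<close> and \<open>0.7676 = 2 * 0.3838\<close>, while
    \<open>1 + (1 - 0.3838) / 2 = 1.3081\<close>.\<close>
  have bound: "0.5223 \<le> (\<epsilon> + d k) + (1 - (\<beta> - d k)) + 0.7676 * sqrt ((\<epsilon> + d k) * (1 - (\<beta> - d k)))" for k
  proof -
    have dk: "d k > 0"
      by (simp add: d_def)
    have "2 powr ((1 - (\<epsilon> + d k)) * real n) \<le> 2 powr ((1 - \<epsilon>) * real n)"
      "2 powr ((\<beta> - d k) * real n) \<le> 2 powr (\<beta> * real n)"
      using dk by (auto intro!: mult_right_mono)
    then have "2 powr ((1 - (\<epsilon> + d k)) * real n) \<le> card A" "2 powr ((\<beta> - d k) * real n) \<le> card B"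
      using assms(4,5) by linarith+
    then have "(1 - 0.3838\<^sup>2) * (1 - log 2 (1 + (1 - 0.3838) / 2))
        \<le> (\<epsilon> + d k) + (1 - (\<beta> - d k)) + 2 * 0.3838 * sqrt ((\<epsilon> + d k) * (1 - (\<beta> - d k)))"
      using dk assms \<open>\<beta> \<le> 1\<close> by (intro UDCP_exponent_ge) auto
    moreover have "(1 - 0.3838\<^sup>2) * (1 - 0.3874733)
        \<le> (1 - 0.3838\<^sup>2) * (1 - log 2 (1 + (1 - 0.3838) / 2) :: real)"
      using log2_1_3081_le by (intro mult_left_mono) (auto simp: power2_eq_square)
    ultimately show ?thesis
      by (simp add: power2_eq_square)
  qed
  have "(\<lambda>k. (\<epsilon> + d k) + (1 - (\<beta> - d k)) + 0.7676 * sqrt ((\<epsilon> + d k) * (1 - (\<beta> - d k))))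
      \<longlonglongrightarrow> (\<epsilon> + 0) + (1 - (\<beta> - 0)) + 0.7676 * sqrt ((\<epsilon> + 0) * (1 - (\<beta> - 0)))"
    by (intro tendsto_intros d)
  then have "0.5223 \<le> (\<epsilon> + 0) + (1 - (\<beta> - 0)) + 0.7676 * sqrt ((\<epsilon> + 0) * (1 - (\<beta> - 0)))"
    by (rule LIMSEQ_le_const) (use bound in blast)
  then show ?thesis
    by simp
qed

end
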